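(* Let $\mathcal T$ be the variable returns-to-scale technology set generated by data $\mathbf X\in\mathbb R^{m\times n}$, $\mathbf Y\in\mathbb R^{s\times n}$, with ideal point $(\mathbf x^{\min},\mathbf y^{\max})$. The following are equivalent. (i) $\mathcal T$ is the intersection of the $m+s$ half-spaces $\mathcal H_i^x$ ($i=1,\dots,m$) and $\mathcal H_r^y$ ($r=1,\dots,s$) and a finite number of facet-defining half-spaces $\mathcal H(\mathbf u,\mathbf v,\sigma)$ with (componentwise) positive $\mathbf u$ and $\mathbf v$. (ii) The closure of the weakly efficient boundary satisfies $\operatorname{cl}\partial^W\mathcal T=\left(\bigcup_{i=1}^m\mathcal F_i^x\right)\cup\left(\bigcup_{r=1}^s\mathcal F_r^y\right)$. (iii) The weakly efficient boundary satisfies $\partial^W\mathcal T=\left[\left(\bigcup_{i=1}^m\mathcal F_i^x\right)\cup\left(\bigcup_{r=1}^s\mathcal F_r^y\right)\right]\setminus\partial^S\mathcal T$. (iv) For each of the $m+s$ input–output coordinates there is a generating unit $(\mathbf x_j,\mathbf y_j)$, $j\in\{1,\dots,n\}$, which coincides with the ideal point except perhaps in this one coordinate; that is, for each $i'\in\{1,\dots,m\}$ there exists $j\in\{1,\dots,n\}$ such that $x_{ij}=x_i^{\min}$ for all $i\ne i'$ and $\mathbf y_j=\mathbf y^{\max}$; and for each $r'\in\{1,\dots,s\}$ there exists $j\in\{1,\dots,n\}$ such that $\mathbf x_j=\mathbf x^{\min}$ and $y_{rj}=y_r^{\max}$ for all $r\neq r'$. (v) For each of the $m+s$ input–output coordinates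 there is a point in $\mathcal T$ that coincides with the ideal point except perhaps in this one coordinate; that is, for each $i\in\{1,\dots,m\}$ there exists $\delta^x\ge0$ such that $(\mathbf x^{\min},\mathbf y^{\max})+\delta^x(\mathbf e_i^x,\mathbf 0_s)\in\mathcal T$, and for each $r\in\{1,\dots,s\}$ there exists $\delta^y\ge0$ such that $(\mathbf x^{\min},\mathbf y^{\max})-\delta^y(\mathbf 0_m,\mathbf e_r^y)\in\mathcal T$. (vi) Each point of the weakly efficient frontier coincides with the ideal point in at least one component; that is, for each $(\mathbf x,\mathbf y)\in\partial^W\mathcal T$ there exists $i\in\{1,\dots,m\}$ with $x_i=x_i^{\min}$ or $r\in\{1,\dots,s\}$ with $y_r=y_r^{\max}$.
   Context: $\mathbf X=(x_{ij})=[\mathbf x_1,\dots,\mathbf x_n]\in\mathbb R^{m\times n}$ and $\mathbf Y=(y_{rj})=[\mathbf y_1,\dots,\mathbf y_n]\in\mathbb R^{s\times n}$ are input and output data (no sign restriction); the pairs $(\mathbf x_j,\mathbf y_j)$ are the generating units. With $\mathbf e$ the vector of ones, $\mathcal T=\{(\mathbf x,\mathbf y)\in\mathbb R^m\times\mathbb R^s:\ \mathbf X\boldsymbol\lambda\le\mathbf x,\ \mathbf Y\boldsymbol\lambda\ge\mathbf y \text{ for some } \boldsymbol\lambda\ge 0,\ \mathbf e^\top\boldsymbol\lambda=1\}$. The ideal point is $(\mathbf x^{\min},\mathbf y^{\max})$ with $x_i^{\min}=\min_j x_{ij}$, $y_r^{\max}=\max_j y_{rj}$. A point $(\mathbf x_o,\mathbf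 y_o)$ dominates a distinct point $(\mathbf x_p,\mathbf y_p)$ if $\mathbf x_o\le\mathbf x_p$, $\mathbf y_o\ge\mathbf y_p$ componentwise; it strictly dominates it if $\mathbf x_o<\mathbf x_p$, $\mathbf y_o>\mathbf y_p$ in every component. A point of $\mathcal T$ is strongly efficient if no other point of $\mathcal T$ dominates it, and weakly efficient if no point of $\mathcal T$ strictly dominates it. The boundary $\partial\mathcal T$ is the set of weakly efficient points; $\partial^S\mathcal T$ is the set of strongly efficient points and $\partial^W\mathcal T=\partial\mathcal T\setminus\partial^S\mathcal T$ is the weakly efficient boundary (frontier). For $\mathbf u\in\mathbb R^s_+$, $\mathbf v\in\mathbb R^m_+$, $\sigma\in\mathbb R$, $\mathcal H(\mathbf u,\mathbf v,\sigma)=\{(\mathbf x,\mathbf y):\mathbf u^\top\mathbf y-\mathbf v^\top\mathbf x\le\sigma\}$. Such a half-space is facet-defining (for $\mathcal T$) if $\{(\mathbf x,\mathbf y)\in\mathcal T:\mathbf u^\top\mathbf y-\mathbf v^\top\mathbf x=\sigma\}$ is a facet of the polyhedron $\mathcal T$ (a face of dimension $m+s-1$). Further, $\mathcal H_i^x=\{(\mathbf x,\mathbf y):x_i\ge x_i^{\min}\}$, $\mathcal H_r^y=\{(\mathbf x,\mathbf y):y_r\le y_r^{\max}\}$, $\mathcal F_i^x=\{(\mathbf x,\mathbf y)\in\mathcal T:x_i=x_i^{\min}\}$, $\mathcal F_r^y=\{(\mathbf x,\mathbf y)\in\mathcal T:y_r=y_r^{\max}\}$. $\mathbf e_i^x$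 and $\mathbf e_r^y$ are the $i$-th and $r$-th standard unit vectors of $\mathbb R^m$ and $\mathbb R^s$; $\mathbf 0_m,\mathbf 0_s$ are zero vectors. *)

theory Defs
  imports "HOL-Analysis.Analysis"
begin

text \<open>Data \<open>X\<close> (inputs) and \<open>Y\<close> (outputs) are matrices whose columns are indexed by the units
  \<open>'n\<close>; input-output points are pairs in \<open>(real^'m) \<times> (real^'s)\<close>. The order \<open>\<le>\<close> on vectors
  is componentwise; the library's \<open><\<close> on vectors is not, so strict dominance is written out.\<close>

definition vrs_tech :: "real^'n^'m \<Rightarrow> real^'n^'s \<Rightarrow> ((real^'m) \<times> (real^'s)) set" where
  "vrs_tech X Y = {(x, y). \<exists>l::real^'n. (\<forall>j. 0 \<le> l $ j) \<and> (\<Sum>j\<in>UNIV. l $ j) = 1 \<and>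
                            X *v l \<le> x \<and> y \<le> Y *v l}"

definition x_min :: "real^'n^'m \<Rightarrow> real^'m" where
  "x_min X = (\<chi> i. Min (range (\<lambda>j. X $ i $ j)))"

definition y_max :: "real^'n^'s \<Rightarrow> real^'s" where
  "y_max Y = (\<chi> r. Max (range (\<lambda>j. Y $ r $ j)))"

definition dominates :: "(real^'m) \<times> (real^'s) \<Rightarrow> (real^'m) \<times> (real^'s) \<Rightarrow> bool" where
  "dominates p q \<longleftrightarrow> p \<noteq> q \<and> fst p \<le> fst q \<and> snd p \<ge> snd q"

definition strictly_dominates :: "(real^'m) \<times> (real^'s) \<Rightarrow> (real^'m) \<times> (real^'s) \<Rightarrow> bool" where
  "strictly_dominates p q \<longleftrightarrow>
     (\<forall>i. fst p $ i < fst q $ i) \<and> (\<forall>r. snd p $ r > snd q $ r)"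

definition weakly_efficient_set :: "((real^'m) \<times> (real^'s)) set \<Rightarrow> ((real^'m) \<times> (real^'s)) set" where
  "weakly_efficient_set T = {p \<in> T. \<not> (\<exists>q\<in>T. strictly_dominates q p)}"

definition strong_frontier :: "((real^'m) \<times> (real^'s)) set \<Rightarrow> ((real^'m) \<times> (real^'s)) set" where
  "strong_frontier T = {p \<in> T. \<not> (\<exists>q\<in>T. dominates q p)}"

definition weak_frontier :: "((real^'m) \<times> (real^'s)) set \<Rightarrow> ((real^'m) \<times> (real^'s)) set" where
  "weak_frontier T = weakly_efficient_set T - strong_frontier T"

definition halfspace :: "real^'s \<Rightarrow> real^'m \<Rightarrow> real \<Rightarrow> ((real^'m) \<times> (real^'s)) set" where
  "halfspace u v \<sigma> = {(x, y). u \<bullet> y - v \<bullet> x \<le> \<sigma>}"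

definition facet_defining ::
  "((real^'m) \<times> (real^'s)) set \<Rightarrow> real^'s \<Rightarrow> real^'m \<Rightarrow> real \<Rightarrow> bool" where
  "facet_defining T u v \<sigma> \<longleftrightarrow> {(x, y) \<in> T. u \<bullet> y - v \<bullet> x = \<sigma>} facet_of T"

text \<open>\<open>facet_of\<close> asks for codimension one relative to \<open>T\<close>. The technology set is
  full-dimensional, so its facets are exactly its faces of dimension \<open>m + s - 1\<close>.\<close>

lemma aff_dim_vrs_tech:
  fixes X :: "real^'n^'m" and Y :: "real^'n^'s"
  shows "aff_dim (vrs_tech X Y) = int CARD('m) + int CARD('s)"
proof -
  define a where "a = X *v axis (undefined::'n) 1"
  define b where "b = Y *v axis (undefined::'n) 1"
  define U where "U = box a (a + One) \<times> box (b - One) b"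
  have ne: "box a (a + One) \<noteq> {}" "box (b - One) b \<noteq> {}"
    by (auto simp: box_ne_empty inner_simps)
  have "U \<subseteq> vrs_tech X Y"
  proof
    fix p assume p: "p \<in> U"
    have "a \<le> fst p" "snd p \<le> b"
      using p by (auto simp: U_def mem_box_cart less_eq_vec_def less_imp_le)
    moreover have "\<forall>j. 0 \<le> (axis (undefined::'n) 1 :: real^'n) $ j"
      "(\<Sum>j\<in>UNIV. (axis (undefined::'n) 1 :: real^'n) $ j) = 1"
      by (auto simp: axis_def)
    ultimately show "p \<in> vrs_tech X Y"
      unfolding vrs_tech_def a_def b_def by (auto simp: case_prod_beta)
  qed
  moreover have "open U" "U \<noteq> {}"
    using ne by (auto simp: U_def intro!: open_Times open_box)
  ultimately have "interior (vrs_tech X Y) \<noteq> {}"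
    using interior_maximal by blast
  then show ?thesis
    by (simp add: aff_dim_nonempty_interior)
qed

definition ideal_halfspace_x :: "real^'n^'m \<Rightarrow> 'm \<Rightarrow> ((real^'m) \<times> (real^'s)) set" where
  "ideal_halfspace_x X i = {(x, y). x $ i \<ge> x_min X $ i}"

definition ideal_halfspace_y :: "real^'n^'s \<Rightarrow> 's \<Rightarrow> ((real^'m) \<times> (real^'s)) set" where
  "ideal_halfspace_y Y r = {(x, y). y $ r \<le> y_max Y $ r}"

definition ideal_face_x ::
  "real^'n^'m \<Rightarrow> real^'n^'s \<Rightarrow> 'm \<Rightarrow> ((real^'m) \<times> (real^'s)) set" where
  "ideal_face_x X Y i = {(x, y) \<in> vrs_tech X Y. x $ i = x_min X $ i}"

definition ideal_face_y ::
  "real^'n^'m \<Rightarrow> real^'n^'s \<Rightarrow> 's \<Rightarrow> ((real^'m) \<times> (real^'s)) set" where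
  "ideal_face_y X Y r = {(x, y) \<in> vrs_tech X Y. y $ r = y_max Y $ r}"

definition all_equivalent :: "bool list \<Rightarrow> bool" where
  "all_equivalent Ps \<longleftrightarrow> (\<forall>P\<in>set Ps. \<forall>Q\<in>set Ps. P \<longleftrightarrow> Q)"

end

theory Submission imports Defs begin

text \<open>The proof rests on the cycle (vi) \<open>\<Longrightarrow>\<close> (v) \<open>\<Longrightarrow>\<close> (i) \<open>\<Longrightarrow>\<close> (vi). If the axis through the ideal point in
  direction \<open>k\<close> misses the technology set, the boundary far out in that direction contains weakly but
  not strongly efficient points that exceed the ideal point in every coordinate. If all these axes
  meet the technology set, every facet inequality with a vanishing weight is implied by the ideal
  half-spaces. If all other inequalities have positive weights, a dominated point off the ideal
  half-spaces' boundaries is interior. Conditions (ii) and (iii) only rephrase (vi), because the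
  points with an ideal coordinate are always weakly efficient, and (iv) rephrases (v), because a
  convex combination attains the minimum of a coordinate only if every unit involved does.\<close>

section \<open>Signed coordinates\<close>

text \<open>Outputs are counted with a negative sign, so that dominance becomes the componentwise order
  and inputs and outputs need not be distinguished.\<close>

fun coord :: "'m + 's \<Rightarrow> (real^'m) \<times> (real^'s) \<Rightarrow> real" where
  "coord (Inl i) p = fst p $ i"
| "coord (Inr r) p = - (snd p $ r)"

fun dir :: "'m + 's \<Rightarrow> (real^'m) \<times> (real^'s)" where
  "dir (Inl i) = (axis i 1, 0)"
| "dir (Inr r) = (0, - axis r 1)"

abbreviation coord_le :: "(real^'m) \<times> (real^'s) \<Rightarrow> (real^'m) \<times> (real^'s) \<Rightarrow> bool" where
  "coord_le p q \<equiv> \<forall>k. coord k p \<le> coord k q"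

lemma linear_coord: "linear (coord k)"
  by (cases k) (auto intro!: linearI)

lemmas coord_simps [simp] =
  linear_add[OF linear_coord] linear_diff[OF linear_coord] linear_0[OF linear_coord]
  linear_cmul[OF linear_coord] linear_sum[OF linear_coord]

lemma coord_dir [simp]: "coord k (dir l) = (if k = l then 1 else 0)"
  by (cases k; cases l) (auto simp: axis_def)

lemma all_sum_iff: "(\<forall>k. P k) \<longleftrightarrow> (\<forall>i. P (Inl i)) \<and> (\<forall>r. P (Inr r))"
  by (metis sum.exhaust)

lemma ex_sum_iff: "(\<exists>k. P k) \<longleftrightarrow> (\<exists>i. P (Inl i)) \<or> (\<exists>r. P (Inr r))"
  by (metis sum.exhaust)

lemma coord_eqI: "(\<And>k. coord k p = coord k q) \<Longrightarrow> p = q"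
  by (metis coord.simps neg_equal_iff_equal prod_eqI vec_eq_iff)

lemma coord_expand: "(\<Sum>k\<in>UNIV. coord k p *\<^sub>R dir k) = p"
  by (rule coord_eqI) (simp add: if_distrib cong: if_cong)

text \<open>Expansion along the signed directions. The signs of the weights
  \<open>a \<bullet> dir k\<close> decide whether the functional is monotone for the dominance
  order.\<close>

lemma inner_eq_sum_coord: "a \<bullet> p = (\<Sum>k\<in>UNIV. coord k p * (a \<bullet> dir k))"
  by (subst coord_expand[symmetric]) (simp add: inner_sum_right)

lemma dominates_iff: "dominates p q \<longleftrightarrow> p \<noteq> q \<and> coord_le p q"
  by (auto simp: dominates_def less_eq_vec_def all_sum_iff)

lemma strictly_dominates_iff: "strictly_dominates p q \<longleftrightarrow> (\<forall>k. coord k p < coord k q)"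
  by (auto simp: strictly_dominates_def all_sum_iff)

text \<open>Both index types are nonempty, so there is at least one input and one output
  coordinate.\<close>

lemma exists_other_coord: "\<exists>l::'m + 's. l \<noteq> k"
  by (metis Inl_Inr_False)

section \<open>The technology set\<close>

definition gen_unit :: "real^'n^'m \<Rightarrow> real^'n^'s \<Rightarrow> 'n \<Rightarrow> (real^'m) \<times> (real^'s)" where
  "gen_unit X Y j = (column j X, column j Y)"

abbreviation ideal :: "real^'n^'m \<Rightarrow> real^'n^'s \<Rightarrow> (real^'m) \<times> (real^'s)" where
  "ideal X Y \<equiv> (x_min X, y_max Y)"

lemma vrs_tech_iff:
  fixes X :: "real^'n^'m" and Y :: "real^'n^'s"
  shows
  "p \<in> vrs_tech X Y \<longleftrightarrow>
    (\<exists>l::real^'n. (\<forall>j. 0 \<le> l $ j) \<and> (\<Sum>j\<in>UNIV. l $ j) = 1 \<and>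
      coord_le (\<Sum>j\<in>UNIV. l $ j *\<^sub>R gen_unit X Y j) p)"
proof -
  have "coord_le (\<Sum>j\<in>UNIV. l $ j *\<^sub>R gen_unit X Y j) p \<longleftrightarrow> X *v l \<le> fst p \<and> snd p \<le> Y *v l"
    for l :: "real^'n"
    by (simp add: all_sum_iff gen_unit_def less_eq_vec_def column_def matrix_vector_mult_def
        sum_negf mult.commute)
  then show ?thesis
    by (auto simp: vrs_tech_def case_prod_beta)
qed

text \<open>Free disposability: the same convex combination of units serves as a witness for
  \<open>q\<close>.\<close>

lemma vrs_tech_upward: "p \<in> vrs_tech X Y \<Longrightarrow> coord_le p q \<Longrightarrow> q \<in> vrs_tech X Y"
  unfolding vrs_tech_iff by (meson order_trans)

lemma gen_unit_in_vrs_tech: "gen_unit X Y j \<in> vrs_tech X Y"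
  unfolding vrs_tech_iff
  by (rule exI[of _ "axis j 1"]) (auto simp: axis_def if_distrib if_distribR cong: if_cong)

lemma coord_ideal_le_unit: "coord k (ideal X Y) \<le> coord k (gen_unit X Y j)"
  by (cases k) (auto simp: x_min_def y_max_def gen_unit_def column_def)

text \<open>The bound holds for each unit, hence for convex combinations, hence for every point
  above one.\<close>

lemma coord_ideal_le:
  fixes X :: "real^'n^'m" and Y :: "real^'n^'s"
  assumes "p \<in> vrs_tech X Y"
  shows "coord k (ideal X Y) \<le> coord k p"
proof -
  obtain l :: "real^'n" where l: "\<forall>j. 0 \<le> l $ j" "(\<Sum>j\<in>UNIV. l $ j) = 1"
    "coord_le (\<Sum>j\<in>UNIV. l $ j *\<^sub>R gen_unit X Y j) p"
    using assms by (auto simp: vrs_tech_iff)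
  have "coord k (ideal X Y) = (\<Sum>j\<in>UNIV. l $ j * coord k (ideal X Y))"
    using l(2) by (simp flip: sum_distrib_right)
  also have "\<dots> \<le> coord k (\<Sum>j\<in>UNIV. l $ j *\<^sub>R gen_unit X Y j)"
    using l(1) by (auto intro!: sum_mono mult_left_mono coord_ideal_le_unit simp del: coord.simps)
  finally show ?thesis
    using l(3) order_trans by blast
qed

lemma weak_frontier_vrs_tech_iff:
  "p \<in> weak_frontier (vrs_tech X Y) \<longleftrightarrow> p \<in> vrs_tech X Y \<and>
    \<not> (\<exists>q\<in>vrs_tech X Y. \<forall>k. coord k q < coord k p) \<and> (\<exists>q\<in>vrs_tech X Y. q \<noteq> p \<and> coord_le q p)"
  by (auto simp: weak_frontier_def weakly_efficient_set_def strong_frontier_def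
      dominates_iff strictly_dominates_iff)

lemma ideal_faces_eq:
  "(\<Union>i. ideal_face_x X Y i) \<union> (\<Union>r. ideal_face_y X Y r) =
    {p \<in> vrs_tech X Y. \<exists>k. coord k p = coord k (ideal X Y)}"
  by (auto simp: ideal_face_x_def ideal_face_y_def ex_sum_iff)

text \<open>A strict dominator would lie below the ideal value in coordinate
  \<open>k\<close>.\<close>

lemma ideal_faces_subset_weakly_efficient:
  assumes "p \<in> vrs_tech X Y" "coord k p = coord k (ideal X Y)"
  shows "p \<in> weakly_efficient_set (vrs_tech X Y)"
proof -
  have "\<not> strictly_dominates q p" if "q \<in> vrs_tech X Y" for q
    using coord_ideal_le[OF that, of k] assms(2) not_less unfolding strictly_dominates_iff by metis
  then show ?thesis
    using assms(1) by (auto simp: weakly_efficient_set_def)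
qed

section \<open>Polyhedrality of the technology set\<close>

lemma polyhedron_slice:
  fixes C :: "('a::euclidean_space \<times> 'b::euclidean_space) set"
  assumes "polyhedron C"
  shows "polyhedron {z. (z, w) \<in> C}"
proof -
  obtain F where F: "finite F" "C = \<Inter>F" "\<forall>h\<in>F. \<exists>a b. a \<noteq> 0 \<and> h = {x. a \<bullet> x \<le> b}"
    using assms unfolding polyhedron_def by (elim exE conjE) (rule that)
  have "polyhedron {z. (z, w) \<in> h}" if h: "h \<in> F" for h
  proof -
    obtain a b where "h = {x. a \<bullet> x \<le> b}"
      using bspec[OF F(3) h] by (elim exE conjE) (rule that)
    \<comment> \<open>Fixing \<open>w\<close> moves its contribution to the bound. The remaining
      normal \<open>fst a\<close> may be zero; the set is a polyhedron in that case too.\<close>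
    then have "{z. (z, w) \<in> h} = {z. fst a \<bullet> z \<le> b - snd a \<bullet> w}"
      by (auto simp: inner_prod_def)
    then show ?thesis
      by (simp add: polyhedron_halfspace_le)
  qed
  moreover have "{z. (z, w) \<in> C} = \<Inter> ((\<lambda>h. {z. (z, w) \<in> h}) ` F)"
    using F(2) by auto
  ultimately show ?thesis
    using F(1) by (auto intro!: polyhedron_Inter)
qed

text \<open>Homogenization: the technology set is the slice at height 1 of the cone generated by the units at
  height 1 and the coordinate directions at height 0.\<close>

lemma polyhedron_vrs_tech:
  fixes X :: "real^'n^'m" and Y :: "real^'n^'s"
  shows "polyhedron (vrs_tech X Y)"
proof -
  define G where "G = range (\<lambda>j. (gen_unit X Y j, 1::real)) \<union> range (\<lambda>k. (dir k, 0))"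
  \<comment> \<open>An explicit convex cone containing the generators. It bounds the hull from
    above; the reverse inclusion is shown only at height 1.\<close>
  define C' where "C' = {(p, t). \<exists>l::real^'n. (\<forall>j. 0 \<le> l $ j) \<and> (\<Sum>j\<in>UNIV. l $ j) = t \<and>
      coord_le (\<Sum>j\<in>UNIV. l $ j *\<^sub>R gen_unit X Y j) p}"
  have cone: "convex_cone hull G \<subseteq> C'"
  proof (rule hull_minimal)
    have "(gen_unit X Y j, 1) \<in> C'" for j
      unfolding C'_def
      by (auto intro!: exI[of _ "axis j 1"] simp: axis_def if_distrib if_distribR cong: if_cong)
    moreover have "(dir k, 0) \<in> C'" for k
      unfolding C'_def by (auto intro!: exI[of _ 0])
    ultimately show "G \<subseteq> C'"
      by (auto simp: G_def)
    have "(0, 0) \<in> C'"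
      unfolding C'_def by (auto intro!: exI[of _ 0])
    moreover have "(p + q, t + u) \<in> C'" if pq: "(p, t) \<in> C'" "(q, u) \<in> C'" for p q t u
    proof -
      obtain l l' :: "real^'n" where
        "\<forall>j. 0 \<le> l $ j" "(\<Sum>j\<in>UNIV. l $ j) = t" "coord_le (\<Sum>j\<in>UNIV. l $ j *\<^sub>R gen_unit X Y j) p"
        "\<forall>j. 0 \<le> l' $ j" "(\<Sum>j\<in>UNIV. l' $ j) = u" "coord_le (\<Sum>j\<in>UNIV. l' $ j *\<^sub>R gen_unit X Y j) q"
        using pq by (auto simp: C'_def)
      then show ?thesis
        unfolding C'_def
        by (auto intro!: exI[of _ "l + l'"] add_mono simp: sum.distrib distrib_right)
    qed
    moreover have "(c *\<^sub>R p, c * t) \<in> C'" if p: "(p, t) \<in> C'" and c: "0 \<le> c" for p t c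
    proof -
      obtain l :: "real^'n" where
        "\<forall>j. 0 \<le> l $ j" "(\<Sum>j\<in>UNIV. l $ j) = t" "coord_le (\<Sum>j\<in>UNIV. l $ j *\<^sub>R gen_unit X Y j) p"
        using p by (auto simp: C'_def)
      then show ?thesis
        unfolding C'_def using c
        by (auto intro!: exI[of _ "c *\<^sub>R l"] mult_left_mono
            simp: mult.assoc simp flip: sum_distrib_left)
    qed
    ultimately show "convex_cone C'"
      by (auto simp: convex_cone_iff zero_prod_def)
  qed
  have "(p, 1) \<in> convex_cone hull G" if p: "p \<in> vrs_tech X Y" for p
  proof -
    obtain l :: "real^'n" where l: "\<forall>j. 0 \<le> l $ j" "(\<Sum>j\<in>UNIV. l $ j) = 1"
      "coord_le (\<Sum>j\<in>UNIV. l $ j *\<^sub>R gen_unit X Y j) p"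
      using p unfolding vrs_tech_iff by (elim exE conjE) (rule that)
    \<comment> \<open>The slack of \<open>p\<close> has nonnegative signed coordinates, so it is a
      conic combination of the directions at height 0.\<close>
    define d where "d = p - (\<Sum>j\<in>UNIV. l $ j *\<^sub>R gen_unit X Y j)"
    have sums: "sum f A \<in> convex_cone hull G"
      if "\<And>i. i \<in> A \<Longrightarrow> f i \<in> convex_cone hull G" for A :: "'i set" and f
      using that
      by (induction A rule: infinite_finite_induct)
        (auto intro: convex_cone_hull_contains_0 convex_cone_hull_add)
    have "(\<Sum>j\<in>UNIV. l $ j *\<^sub>R (gen_unit X Y j, 1::real)) + (\<Sum>k\<in>UNIV. coord k d *\<^sub>R (dir k, 0))
        \<in> convex_cone hull G"
      using l by (intro convex_cone_hull_add sums convex_cone_hull_mul hull_inc)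
        (auto simp: G_def d_def)
    moreover have "(\<Sum>k\<in>UNIV. coord k d *\<^sub>R (dir k, 0::real)) = (d, 0)"
      by (simp add: prod_eq_iff fst_sum snd_sum coord_expand)
    moreover have "(\<Sum>j\<in>UNIV. l $ j *\<^sub>R (gen_unit X Y j, 1::real)) = (p - d, 1)"
      using l(2) by (simp add: prod_eq_iff fst_sum snd_sum d_def)
    ultimately show ?thesis
      by simp
  qed
  moreover have "p \<in> vrs_tech X Y" if "(p, 1) \<in> convex_cone hull G" for p
    using subsetD[OF cone that] by (auto simp: C'_def vrs_tech_iff)
  ultimately have "vrs_tech X Y = {p. (p, 1) \<in> convex_cone hull G}"
    by blast
  moreover have "finite G"
    by (simp add: G_def)
  ultimately show ?thesis
    by (simp add: polyhedron_slice polyhedron_convex_cone_hull)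
qed


section \<open>Interior points and half-spaces\<close>

lemma interior_imp_strictly_dominated:
  assumes "p \<in> interior S"
  shows "\<exists>q\<in>S. \<forall>k. coord k q < coord k p"
proof -
  obtain e where e: "e > 0" "ball p e \<subseteq> S"
    using assms by (auto simp: mem_interior)
  \<comment> \<open>Moving against \<open>d\<close> lowers all signed coordinates at once. The added
    1 in \<open>t\<close> keeps the denominator positive.\<close>
  define d :: "(real^'a) \<times> (real^'b)" where "d = (\<Sum>k\<in>UNIV. dir k)"
  define t where "t = e / 2 / (norm d + 1)"
  have "norm d + 1 > 0"
    by (simp add: add_nonneg_pos)
  then have "t > 0"
    using e(1) by (simp add: t_def)
  have "0 \<le> t * norm d"
    using \<open>t > 0\<close> by simp
  then have "t * norm d < 2 * (t * (norm d + 1))"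
    using \<open>t > 0\<close> unfolding distrib_left by linarith
  also have "\<dots> = e"
    using \<open>norm d + 1 > 0\<close> by (simp add: t_def del: distrib_left_numeral distrib_right_numeral)
  finally have "t * norm d < e" .
  then have "p - t *\<^sub>R d \<in> ball p e"
    using \<open>t > 0\<close> by (simp add: dist_norm)
  then have "p - t *\<^sub>R d \<in> S"
    using e(2) by blast
  moreover have "coord k (p - t *\<^sub>R d) < coord k p" for k
    using \<open>t > 0\<close> by (simp add: d_def)
  ultimately show ?thesis
    by blast
qed

lemma halfspace_eq: "halfspace u v \<sigma> = {p. (- v, u) \<bullet> p \<le> \<sigma>}"
  by (auto simp: halfspace_def inner_prod_def)

lemma ideal_halfspaces_eq:
  "(\<Inter>i. ideal_halfspace_x X i) \<inter> (\<Inter>r. ideal_halfspace_y Y r) = {p. coord_le (ideal X Y) p}"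
  by (auto simp: ideal_halfspace_x_def ideal_halfspace_y_def all_sum_iff)

section \<open>Ideal faces and the weakly efficient frontier\<close>

text \<open>A dominated point has slack in every half-space with positive weights; if it also has slack in
  the ideal half-spaces, it is interior.\<close>

lemma weak_frontier_meets_ideal_if_halfspaces:
  fixes X :: "real^'n^'m" and Y :: "real^'n^'s"
  assumes fin: "finite P"
    and pos: "\<And>u v \<sigma>. (u, v, \<sigma>) \<in> P \<Longrightarrow> (\<forall>r. u $ r > 0) \<and> (\<forall>i. v $ i > 0)"
    and T: "vrs_tech X Y = {p. coord_le (ideal X Y) p} \<inter> (\<Inter>(u, v, \<sigma>)\<in>P. halfspace u v \<sigma>)"
    and p: "p \<in> weak_frontier (vrs_tech X Y)"
  shows "\<exists>k. coord k p = coord k (ideal X Y)"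
proof (rule ccontr)
  assume no: "\<nexists>k. coord k p = coord k (ideal X Y)"
  obtain q where q: "q \<in> vrs_tech X Y" "q \<noteq> p" "coord_le q p"
    using p by (auto simp: weak_frontier_vrs_tech_iff)
  obtain k0 where "coord k0 q \<noteq> coord k0 p"
    using q(2) coord_eqI by blast
  then have k0: "coord k0 q < coord k0 p"
    using q(3) by (simp add: less_le)
  \<comment> \<open>All inequalities made strict: an open subset of the technology set, which will
    contain \<open>p\<close>.\<close>
  define U where "U = (\<Inter>k. {z. coord k (ideal X Y) < coord k z}) \<inter>
    (\<Inter>(u, v, \<sigma>)\<in>P. {z. (- v, u) \<bullet> z < \<sigma>})"
  have "open {z. coord k (ideal X Y) < coord k z}" for k
    by (intro open_Collect_less continuous_intros linear_continuous_on_compose[OF _ linear_coord])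
  then have "open U"
    unfolding U_def using fin
    by (intro open_Int open_INT) (auto simp: open_halfspace_lt split: prod.splits)
  moreover have "U \<subseteq> vrs_tech X Y"
    unfolding T U_def halfspace_eq by (auto simp: less_imp_le)
  moreover have "p \<in> U"
  proof -
    have "(- v, u) \<bullet> p < \<sigma>" if uv: "(u, v, \<sigma>) \<in> P" for u v \<sigma>
    proof -
      have neg: "(- v, u) \<bullet> dir k < 0" for k
        using pos[OF uv] by (cases k) (auto simp: inner_axis)
      have "(- v, u) \<bullet> p < (- v, u) \<bullet> q"
        unfolding inner_eq_sum_coord[of _ p] inner_eq_sum_coord[of _ q]
        using q(3) neg k0
        by (intro sum_strict_mono_ex1) (auto intro!: mult_right_mono_neg mult_strict_right_mono_neg
            simp: less_imp_le)
      also have "\<dots> \<le> \<sigma>"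
        using q(1) uv unfolding T halfspace_eq by auto
      finally show ?thesis .
    qed
    moreover have "coord k (ideal X Y) < coord k p" for k
      using no p coord_ideal_le[of p X Y k] unfolding weak_frontier_vrs_tech_iff
      by (metis order_le_less)
    ultimately show ?thesis
      by (auto simp: U_def)
  qed
  ultimately have "p \<in> interior (vrs_tech X Y)"
    by (auto simp: interior_def)
  then show False
    using p interior_imp_strictly_dominated weak_frontier_vrs_tech_iff by blast
qed

text \<open>A valid inequality with a vanishing weight on coordinate \<open>k\<close> is satisfied by the ideal point, since
  the point of the technology set on the axis through it in direction \<open>k\<close> has the same value.
  Hence it follows from the ideal half-spaces.\<close>

lemma halfspaces_if_axis_points:
  fixes X :: "real^'n^'m" and Y :: "real^'n^'s"
  assumes axis_pts: "\<And>k. \<exists>\<delta>\<ge>0. ideal X Y + \<delta> *\<^sub>R dir k \<in> vrs_tech X Y"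
  shows "\<exists>P. finite P \<and>
    (\<forall>(u, v, \<sigma>)\<in>P. (\<forall>r. u $ r > 0) \<and> (\<forall>i. v $ i > 0) \<and> facet_defining (vrs_tech X Y) u v \<sigma>) \<and>
    vrs_tech X Y = {p. coord_le (ideal X Y) p} \<inter> (\<Inter>(u, v, \<sigma>)\<in>P. halfspace u v \<sigma>)"
proof -
  let ?T = "vrs_tech X Y"
  have aff: "affine hull ?T = UNIV"
    using aff_dim_vrs_tech[of X Y] by (simp flip: aff_dim_eq_full)
  \<comment> \<open>An irredundant representation is chosen because each of its inequalities then
    cuts out a facet.\<close>
  obtain F where F: "finite F" "?T = affine hull ?T \<inter> \<Inter>F"
    "\<forall>h\<in>F. \<exists>a b. a \<noteq> 0 \<and> h = {x. a \<bullet> x \<le> b}"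
    "\<forall>F'. F' \<subset> F \<longrightarrow> ?T \<subset> affine hull ?T \<inter> \<Inter>F'"
    using polyhedron_vrs_tech[of X Y] unfolding polyhedron_Int_affine_minimal by blast
  obtain a b where ab: "\<And>h. h \<in> F \<Longrightarrow> a h \<noteq> 0 \<and> h = {x. a h \<bullet> x \<le> b h}"
    using F(3) by metis
  have valid: "a h \<bullet> p \<le> b h" if "h \<in> F" "p \<in> ?T" for h p
    using F(2) ab[OF that(1)] that by blast
  \<comment> \<open>The technology set is unbounded in direction \<open>dir k\<close>, so a positive
    weight would eventually violate the inequality; \<open>t\<close> below overshoots the bound by
    1.\<close>
  have weights: "a h \<bullet> dir k \<le> 0" if h: "h \<in> F" for h k
  proof (rule ccontr)
    assume "\<not> a h \<bullet> dir k \<le> 0"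
    then have pos: "a h \<bullet> dir k > 0"
      by simp
    obtain p where p: "p \<in> ?T"
      using gen_unit_in_vrs_tech by blast
    define t where "t = (b h - a h \<bullet> p + 1) / (a h \<bullet> dir k)"
    have "t \<ge> 0"
      using valid[OF h p] pos by (simp add: t_def)
    then have "p + t *\<^sub>R dir k \<in> ?T"
      by (intro vrs_tech_upward[OF p]) auto
    from valid[OF h this] show False
      using pos by (simp add: t_def inner_right_distrib)
  qed
  \<comment> \<open>Only inequalities with all weights nonzero are kept. The sign change on inputs
    matches the form of \<open>halfspace\<close>.\<close>
  define P where "P = (\<lambda>h. (snd (a h), - fst (a h), b h)) ` {h\<in>F. \<forall>k. a h \<bullet> dir k < 0}"
  have "finite P"
    using F(1) by (simp add: P_def)
  moreover have "(\<forall>r. u $ r > 0) \<and> (\<forall>i. v $ i > 0) \<and> facet_defining ?T u v \<sigma>"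
    if "(u, v, \<sigma>) \<in> P" for u v \<sigma>
  proof -
    obtain h where h: "h \<in> F" "\<forall>k. a h \<bullet> dir k < 0" "u = snd (a h)" "v = - fst (a h)" "\<sigma> = b h"
      using \<open>(u, v, \<sigma>) \<in> P\<close> by (auto simp: P_def)
    have "?T \<inter> {x. a h \<bullet> x = b h} facet_of ?T"
      using facet_of_polyhedron_explicit[OF F(1,2) ab] F(4) h(1) by blast
    moreover have "{(x, y) \<in> ?T. u \<bullet> y - v \<bullet> x = \<sigma>} = ?T \<inter> {x. a h \<bullet> x = b h}"
      by (auto simp: h(3-5) inner_prod_def)
    ultimately show ?thesis
      using h(2) by (auto simp: facet_defining_def all_sum_iff h(3,4) inner_prod_def inner_axis)
  qed
  moreover have "?T = {p. coord_le (ideal X Y) p} \<inter> (\<Inter>(u, v, \<sigma>)\<in>P. halfspace u v \<sigma>)" (is "_ = ?R")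
  proof
    show "?T \<subseteq> ?R"
      using valid coord_ideal_le[of _ X Y] by (auto simp: P_def halfspace_eq simp del: coord.simps)
    show "?R \<subseteq> ?T"
    proof
      fix z assume z: "z \<in> ?R"
      have "a h \<bullet> z \<le> b h" if h: "h \<in> F" for h
      proof (cases "\<forall>k. a h \<bullet> dir k < 0")
        case True
        then show ?thesis
          using z h by (auto simp: P_def halfspace_eq)
      next
        case False
        then obtain k where k: "a h \<bullet> dir k = 0"
          using weights[OF h] by (metis order_le_less)
        obtain \<delta> where "ideal X Y + \<delta> *\<^sub>R dir k \<in> ?T"
          using axis_pts by blast
        then have "a h \<bullet> ideal X Y \<le> b h"
          using valid[OF h] k by (fastforce simp: inner_right_distrib)
        moreover have "a h \<bullet> z \<le> a h \<bullet> ideal X Y"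
          unfolding inner_eq_sum_coord[of _ z] inner_eq_sum_coord[of _ "ideal X Y"]
          using z weights[OF h] by (intro sum_mono mult_right_mono_neg) auto
        ultimately show ?thesis
          by simp
      qed
      then show "z \<in> ?T"
        using F(2) ab aff by blast
    qed
  qed
  ultimately show ?thesis
    by (intro exI[of _ P]) blast
qed

text \<open>If the axis misses the technology set, start far out on it and increase all other coordinates
  simultaneously: the point of entry into the set contradicts the assumption.\<close>

lemma axis_points_if_weak_frontier_meets_ideal:
  fixes X :: "real^'n^'m" and Y :: "real^'n^'s"
  assumes meets: "\<And>p. p \<in> weak_frontier (vrs_tech X Y) \<Longrightarrow> \<exists>k. coord k p = coord k (ideal X Y)"
  shows "\<exists>\<delta>\<ge>0. ideal X Y + \<delta> *\<^sub>R dir k \<in> vrs_tech X Y"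
proof -
  let ?T = "vrs_tech X Y"
  \<comment> \<open>On the path \<open>p\<close>, coordinate \<open>k\<close> stays at
    \<open>B + 1\<close>, one above every unit, while \<open>t\<close> raises all other coordinates
    from their ideal values.\<close>
  define B where "B = Max (range (\<lambda>j. coord k (gen_unit X Y j)))"
  define M where "M = B - coord k (ideal X Y) + 1"
  define p where "p t = ideal X Y + t *\<^sub>R ((\<Sum>l\<in>UNIV. dir l) - dir k) + M *\<^sub>R dir k" for t
  have unit_le: "coord k (gen_unit X Y j) \<le> B" for j
    by (simp add: B_def)
  have M: "M > 0"
    using unit_le[of undefined] coord_ideal_le_unit[of k X Y undefined] unfolding M_def by linarith
  have coord_p: "coord l (p t) = coord l (ideal X Y) + (if l = k then M else t)" for l t
    by (simp add: p_def del: coord.simps)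
  define S where "S = {t. 0 \<le> t \<and> p t \<in> ?T}"
  have "S \<noteq> {}"
  proof -
    fix j :: 'n
    \<comment> \<open>The largest gap between this unit and the ideal point, so that
      \<open>p t\<close> lies above the unit.\<close>
    define t where "t = Max (range (\<lambda>l. coord l (gen_unit X Y j) - coord l (ideal X Y)))"
    have t: "coord l (gen_unit X Y j) - coord l (ideal X Y) \<le> t" for l
      unfolding t_def by (rule Max_ge) auto
    have "0 \<le> t"
      using t[of k] coord_ideal_le_unit[of k X Y j] by linarith
    moreover have "p t \<in> ?T"
    proof (rule vrs_tech_upward[OF gen_unit_in_vrs_tech], intro allI)
      show "coord l (gen_unit X Y j) \<le> coord l (p t)" for l
        using t[of l] unit_le[of j] by (simp add: coord_p M_def del: coord.simps)
    qed
    ultimately show ?thesis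
      by (auto simp: S_def)
  qed
  moreover have "bdd_below S"
    by (auto simp: S_def bdd_below_def)
  moreover have "closed S"
  proof -
    have "continuous_on UNIV p"
      unfolding p_def by (intro continuous_intros)
    then have "closed (p -` ?T)"
      using polyhedron_imp_closed[OF polyhedron_vrs_tech]
      by (intro continuous_closed_vimage) (auto simp: continuous_on_eq_continuous_at)
    moreover have "S = {0..} \<inter> p -` ?T"
      by (auto simp: S_def)
    ultimately show ?thesis
      by (simp add: closed_Int)
  qed
  ultimately have inf: "Inf S \<in> S"
    by (rule closed_contains_Inf)
  have least: "Inf S \<le> t" if "t \<in> S" for t
    using that \<open>bdd_below S\<close> by (rule cInf_lower)
  define t where "t = Inf S"
  have t: "0 \<le> t" "p t \<in> ?T"
    using inf by (auto simp: S_def t_def)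
  show ?thesis
  proof (cases "t = 0")
    case True
    then show ?thesis
      using t(2) M by (intro exI[of _ M]) (simp add: p_def)
  next
    case False
    then have "t > 0"
      using t(1) by simp
    obtain w :: "real^'n" where w: "\<forall>j. 0 \<le> w $ j" "(\<Sum>j\<in>UNIV. w $ j) = 1"
      "coord_le (\<Sum>j\<in>UNIV. w $ j *\<^sub>R gen_unit X Y j) (p t)"
      using t(2) by (auto simp: vrs_tech_iff)
    have "(\<Sum>j\<in>UNIV. w $ j * coord k (gen_unit X Y j)) \<le> (\<Sum>j\<in>UNIV. w $ j * B)"
      using w(1) unit_le by (intro sum_mono mult_left_mono) auto
    also have "\<dots> = B"
      using w(2) by (simp flip: sum_distrib_right)
    finally have le_B: "coord k (\<Sum>j\<in>UNIV. w $ j *\<^sub>R gen_unit X Y j) \<le> B"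
      by simp
    \<comment> \<open>Since the combination is at most \<open>B\<close> in coordinate
      \<open>k\<close>, that coordinate of \<open>p t\<close> can drop by 1. Hence
      \<open>p t\<close> is not strongly efficient.\<close>
    have "coord l (\<Sum>j\<in>UNIV. w $ j *\<^sub>R gen_unit X Y j) \<le> coord l (p t - dir k)" for l
      using w(3)[rule_format, of l] le_B by (cases "l = k") (auto simp: coord_p M_def simp del: coord.simps)
    then have "p t - dir k \<in> ?T"
      using w(1,2) unfolding vrs_tech_iff by blast
    moreover have "p t - dir k \<noteq> p t"
    proof
      assume "p t - dir k = p t"
      then have "coord k (p t - dir k) = coord k (p t)"
        by simp
      then show False
        by simp
    qed
    moreover have "coord_le (p t - dir k) (p t)"
      by simp
    moreover have "\<not> (\<forall>l. coord l q < coord l (p t))" if q: "q \<in> ?T" for q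
    proof
      assume less: "\<forall>l. coord l q < coord l (p t)"
      \<comment> \<open>The common slack over \<open>q\<close> would allow an earlier entry at
        \<open>t - \<epsilon>\<close>; the cap by \<open>t\<close> keeps this parameter
        nonnegative.\<close>
      define \<epsilon> where "\<epsilon> = min t (Min (range (\<lambda>l. coord l (p t) - coord l q)))"
      have "\<epsilon> > 0"
        using less \<open>t > 0\<close> by (simp add: \<epsilon>_def)
      have "Min (range (\<lambda>l. coord l (p t) - coord l q)) \<le> coord l (p t) - coord l q" for l
        by (rule Min_le) auto
      then have \<epsilon>: "\<epsilon> \<le> coord l (p t) - coord l q" for l
        unfolding \<epsilon>_def by (meson min.coboundedI2)
      have "p (t - \<epsilon>) \<in> ?T"
      proof (rule vrs_tech_upward[OF q], intro allI)
        show "coord l q \<le> coord l (p (t - \<epsilon>))" for l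
          using less[rule_format, of l] \<epsilon>[of l] by (auto simp: coord_p simp del: coord.simps split: if_splits)
      qed
      then have "t - \<epsilon> \<in> S"
        by (simp add: S_def \<epsilon>_def)
      then show False
        using least \<open>\<epsilon> > 0\<close> unfolding t_def by fastforce
    qed
    ultimately have "p t \<in> weak_frontier ?T"
      using t(2) unfolding weak_frontier_vrs_tech_iff by blast
    \<comment> \<open>Impossible, as each coordinate of \<open>p t\<close> exceeds its ideal value
      by \<open>M\<close> or \<open>t\<close>, both positive.\<close>
    then obtain l where "coord l (p t) = coord l (ideal X Y)"
      using meets by blast
    then show ?thesis
      using M False by (simp add: coord_p del: coord.simps split: if_splits)
  qed
qed

section \<open>Axis units and the closure of the weakly efficient frontier\<close>

lemma axis_point_iff_gen_unit:
  fixes X :: "real^'n^'m" and Y :: "real^'n^'s"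
  shows "(\<exists>\<delta>\<ge>0. ideal X Y + \<delta> *\<^sub>R dir k \<in> vrs_tech X Y) \<longleftrightarrow>
    (\<exists>j. \<forall>l. l \<noteq> k \<longrightarrow> coord l (gen_unit X Y j) = coord l (ideal X Y))"
proof
  assume "\<exists>\<delta>\<ge>0. ideal X Y + \<delta> *\<^sub>R dir k \<in> vrs_tech X Y"
  then obtain \<delta> and w :: "real^'n" where w: "\<forall>j. 0 \<le> w $ j" "(\<Sum>j\<in>UNIV. w $ j) = 1"
    "coord_le (\<Sum>j\<in>UNIV. w $ j *\<^sub>R gen_unit X Y j) (ideal X Y + \<delta> *\<^sub>R dir k)"
    by (auto simp: vrs_tech_iff)
  obtain j where j: "w $ j \<noteq> 0"
    using w(2) by (metis sum.neutral zero_neq_one)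
  have "coord l (gen_unit X Y j) = coord l (ideal X Y)" if "l \<noteq> k" for l
  proof -
    have nonneg: "0 \<le> w $ j' * (coord l (gen_unit X Y j') - coord l (ideal X Y))" for j'
      using w(1) coord_ideal_le_unit[of l X Y j'] by simp
    \<comment> \<open>The weighted gaps to the ideal value are nonnegative with sum at most 0, so
      all vanish, and a unit of nonzero weight has no gap.\<close>
    have "(\<Sum>j'\<in>UNIV. w $ j' * (coord l (gen_unit X Y j') - coord l (ideal X Y)))
        = (\<Sum>j'\<in>UNIV. w $ j' * coord l (gen_unit X Y j')) - coord l (ideal X Y)"
      using w(2) by (simp add: right_diff_distrib sum_subtractf flip: sum_distrib_right)
    also have "\<dots> \<le> 0"
      using w(3)[rule_format, of l] that by (simp del: coord.simps)
    finally have "w $ j * (coord l (gen_unit X Y j) - coord l (ideal X Y)) = 0"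
      using nonneg by (smt (verit, best) UNIV_I finite sum_nonneg sum_nonneg_eq_0_iff)
    then show ?thesis
      using j by simp
  qed
  then show "\<exists>j. \<forall>l. l \<noteq> k \<longrightarrow> coord l (gen_unit X Y j) = coord l (ideal X Y)"
    by blast
next
  assume "\<exists>j. \<forall>l. l \<noteq> k \<longrightarrow> coord l (gen_unit X Y j) = coord l (ideal X Y)"
  then obtain j where j: "\<And>l. l \<noteq> k \<Longrightarrow> coord l (gen_unit X Y j) = coord l (ideal X Y)"
    by blast
  define \<delta> where "\<delta> = coord k (gen_unit X Y j) - coord k (ideal X Y)"
  have "gen_unit X Y j = ideal X Y + \<delta> *\<^sub>R dir k"
    by (rule coord_eqI) (simp add: \<delta>_def j del: coord.simps)
  moreover have "\<delta> \<ge> 0"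
    using coord_ideal_le_unit[of k X Y j] by (simp add: \<delta>_def del: coord.simps)
  ultimately show "\<exists>\<delta>\<ge>0. ideal X Y + \<delta> *\<^sub>R dir k \<in> vrs_tech X Y"
    using gen_unit_in_vrs_tech by metis
qed

text \<open>There are at least two coordinates, so a point of an ideal face can be moved along another
  coordinate inside the face, which makes it dominated.\<close>

lemma ideal_faces_subset_closure_weak_frontier:
  fixes X :: "real^'n^'m" and Y :: "real^'n^'s"
  assumes p: "p \<in> vrs_tech X Y" "coord k p = coord k (ideal X Y)"
  shows "p \<in> closure (weak_frontier (vrs_tech X Y))"
proof -
  obtain l where l: "l \<noteq> k"
    using exists_other_coord by blast
  define q where "q n = p + inverse (real (Suc n)) *\<^sub>R dir l" for n
  have "q n \<in> weak_frontier (vrs_tech X Y)" for n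
  proof -
    have le: "coord_le p (q n)"
      by (simp add: q_def)
    then have T: "q n \<in> vrs_tech X Y"
      using p(1) vrs_tech_upward by blast
    have "coord l (q n) \<noteq> coord l p"
      by (simp add: q_def)
    then have "p \<noteq> q n"
      by metis
    then have "q n \<notin> strong_frontier (vrs_tech X Y)"
      using le p(1) unfolding strong_frontier_def dominates_iff by blast
    moreover have "coord k (q n) = coord k (ideal X Y)"
      using l p(2) by (simp add: q_def del: coord.simps)
    ultimately show ?thesis
      using ideal_faces_subset_weakly_efficient[OF T] by (simp add: weak_frontier_def)
  qed
  moreover have "q \<longlonglongrightarrow> p + 0 *\<^sub>R dir l"
    unfolding q_def by (intro tendsto_intros LIMSEQ_inverse_real_of_nat)
  ultimately show ?thesis
    unfolding closure_sequential by auto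
qed

lemma closed_ideal_faces:
  fixes X :: "real^'n^'m" and Y :: "real^'n^'s"
  shows "closed {p \<in> vrs_tech X Y. \<exists>k. coord k p = coord k (ideal X Y)}"
proof -
  have "closed {p. coord k p = coord k (ideal X Y)}" for k :: "'m + 's"
    by (intro closed_Collect_eq continuous_intros linear_continuous_on_compose[OF _ linear_coord])
  then have "closed (vrs_tech X Y \<inter> (\<Union>k. {p. coord k p = coord k (ideal X Y)}))"
    by (intro closed_Int closed_UN polyhedron_imp_closed polyhedron_vrs_tech) auto
  moreover have "vrs_tech X Y \<inter> (\<Union>k. {p. coord k p = coord k (ideal X Y)}) =
      {p \<in> vrs_tech X Y. \<exists>k. coord k p = coord k (ideal X Y)}"
    by blast
  ultimately show ?thesis
    by simp
qed

section \<open>The equivalences\<close>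

theorem theoremB1:
  fixes X :: "real^'n^'m" and Y :: "real^'n^'s"
  shows "all_equivalent
   [\<comment> \<open>(i)\<close>
    \<exists>P. finite P \<and>
        (\<forall>(u, v, \<sigma>)\<in>P. (\<forall>r. u $ r > 0) \<and> (\<forall>i. v $ i > 0) \<and>
                        facet_defining (vrs_tech X Y) u v \<sigma>) \<and>
        vrs_tech X Y = (\<Inter>i. ideal_halfspace_x X i) \<inter> (\<Inter>r. ideal_halfspace_y Y r)
                         \<inter> (\<Inter>(u, v, \<sigma>)\<in>P. halfspace u v \<sigma>),
    \<comment> \<open>(ii)\<close>
    closure (weak_frontier (vrs_tech X Y)) =
      (\<Union>i. ideal_face_x X Y i) \<union> (\<Union>r. ideal_face_y X Y r),
    \<comment> \<open>(iii)\<close>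
    weak_frontier (vrs_tech X Y) =
      ((\<Union>i. ideal_face_x X Y i) \<union> (\<Union>r. ideal_face_y X Y r)) - strong_frontier (vrs_tech X Y),
    \<comment> \<open>(iv)\<close>
    (\<forall>i'. \<exists>j. (\<forall>i. i \<noteq> i' \<longrightarrow> X $ i $ j = x_min X $ i) \<and> column j Y = y_max Y) \<and>
    (\<forall>r'. \<exists>j. column j X = x_min X \<and> (\<forall>r. r \<noteq> r' \<longrightarrow> Y $ r $ j = y_max Y $ r)),
    \<comment> \<open>(v)\<close>
    (\<forall>i. \<exists>\<delta>\<ge>0. (x_min X, y_max Y) + \<delta> *\<^sub>R (axis i 1, 0) \<in> vrs_tech X Y) \<and>
    (\<forall>r. \<exists>\<delta>\<ge>0. (x_min X, y_max Y) - \<delta> *\<^sub>R (0, axis r 1) \<in> vrs_tech X Y),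
    \<comment> \<open>(vi)\<close>
    \<forall>(x, y)\<in>weak_frontier (vrs_tech X Y).
      (\<exists>i. x $ i = x_min X $ i) \<or> (\<exists>r. y $ r = y_max Y $ r)]"
proof -
  let ?T = "vrs_tech X Y" and ?I = "ideal X Y"
  let ?A = "{p \<in> ?T. \<exists>k. coord k p = coord k ?I}"
  \<comment> \<open>The cycle is run on versions of (vi), (v) and (i) in signed coordinates, to
    which all six conditions are then reduced.\<close>
  define vi where "vi \<longleftrightarrow> (\<forall>p\<in>weak_frontier ?T. \<exists>k. coord k p = coord k ?I)"
  define v where "v \<longleftrightarrow> (\<forall>k. \<exists>\<delta>\<ge>0. ?I + \<delta> *\<^sub>R dir k \<in> ?T)"
  define i where "i \<longleftrightarrow> (\<exists>P. finite P \<and>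
    (\<forall>(u, v, \<sigma>)\<in>P. (\<forall>r. u $ r > 0) \<and> (\<forall>i. v $ i > 0) \<and> facet_defining ?T u v \<sigma>) \<and>
    ?T = {p. coord_le ?I p} \<inter> (\<Inter>(u, v, \<sigma>)\<in>P. halfspace u v \<sigma>))"
  have vi_v: "v" if vi
    unfolding v_def
  proof
    show "\<exists>\<delta>\<ge>0. ?I + \<delta> *\<^sub>R dir k \<in> ?T" for k
      by (rule axis_points_if_weak_frontier_meets_ideal) (use that vi_def in blast)
  qed
  have v_i: "i" if v
    unfolding i_def by (rule halfspaces_if_axis_points) (use that v_def in blast)
  have i_vi: "vi" if asm: i
  proof -
    obtain P where P: "finite P"
      "\<forall>(u, v, \<sigma>)\<in>P. (\<forall>r. u $ r > 0) \<and> (\<forall>i. v $ i > 0) \<and> facet_defining ?T u v \<sigma>"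
      "?T = {p. coord_le ?I p} \<inter> (\<Inter>(u, v, \<sigma>)\<in>P. halfspace u v \<sigma>)"
      using asm unfolding i_def by (elim exE conjE) (rule that)
    show ?thesis
      unfolding vi_def
      by (intro ballI weak_frontier_meets_ideal_if_halfspaces[OF P(1) _ P(3)]) (use P(2) in auto)
  qed
  have iii: "(weak_frontier ?T = ?A - strong_frontier ?T) = vi"
  proof
    assume "weak_frontier ?T = ?A - strong_frontier ?T"
    then show vi
      unfolding vi_def by blast
  next
    assume vi
    \<comment> \<open>placeholder\<close>
    then show "weak_frontier ?T = ?A - strong_frontier ?T"
      using ideal_faces_subset_weakly_efficient
      unfolding vi_def weak_frontier_def weakly_efficient_set_def by fast
  qed
  have ii: "(closure (weak_frontier ?T) = ?A) = vi"
  proof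
    assume "closure (weak_frontier ?T) = ?A"
    then show vi
      using closure_subset unfolding vi_def by blast
  next
    assume vi
    then have "weak_frontier ?T \<subseteq> ?A"
      unfolding vi_def weak_frontier_def weakly_efficient_set_def by blast
    then have "closure (weak_frontier ?T) \<subseteq> ?A"
      using closed_ideal_faces by (rule closure_minimal)
    then show "closure (weak_frontier ?T) = ?A"
      using ideal_faces_subset_closure_weak_frontier by blast
  qed
  have v: "((\<forall>i. \<exists>\<delta>\<ge>0. ?I + \<delta> *\<^sub>R (axis i 1, 0) \<in> ?T) \<and>
      (\<forall>r. \<exists>\<delta>\<ge>0. ?I - \<delta> *\<^sub>R (0, axis r 1) \<in> ?T)) = v"
    by (simp add: v_def all_sum_iff)
  have iv: "((\<forall>i'. \<exists>j. (\<forall>i. i \<noteq> i' \<longrightarrow> X $ i $ j = x_min X $ i) \<and> column j Y = y_max Y) \<and>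
      (\<forall>r'. \<exists>j. column j X = x_min X \<and> (\<forall>r. r \<noteq> r' \<longrightarrow> Y $ r $ j = y_max Y $ r))) = v"
    unfolding v_def axis_point_iff_gen_unit
    by (simp add: all_sum_iff gen_unit_def vec_eq_iff column_def)
  have vi: "(\<forall>(x, y)\<in>weak_frontier ?T.
      (\<exists>i. x $ i = x_min X $ i) \<or> (\<exists>r. y $ r = y_max Y $ r)) = vi"
    by (simp add: vi_def ex_sum_iff case_prod_beta)
  have "i = vi" "v = vi"
    using vi_v v_i i_vi by blast+
  then show ?thesis
    unfolding all_equivalent_def ideal_faces_eq ideal_halfspaces_eq i_def[symmetric] ii iii iv v vi
    by simp
qed

end
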